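(* Let $G$ be a compact (Hausdorff) group with normalized Haar measure $\mathbf{m}$, and let $\alpha$ be an automorphism of $G$ with $\alpha^3=\mathrm{id}$ such that the set $X=\{x\in G : x x^{\alpha} x^{\alpha^2}=1\}$ is measurable and $\mathbf{m}(X)>\frac{15}{16}$. Then $X=G$.
   Context: $x^\alpha$ denotes the image of $x$ under $\alpha$. *)

theory Defs
  imports "HOL-Analysis.Analysis" "HOL-Algebra.Group" "HOL-Algebra.Coset"
begin

definition compact_hausdorff_group :: "('a, 'b) monoid_scheme \<Rightarrow> 'a topology \<Rightarrow> bool" where
  "compact_hausdorff_group G T \<longleftrightarrow>
     group G \<and> topspace T = carrier G \<and> Hausdorff_space T \<and> compact_space T \<and>
     continuous_map (prod_topology T T) T (\<lambda>(x, y). x \<otimes>\<^bsub>G\<^esub> y) \<and>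
     continuous_map T T (\<lambda>x. inv\<^bsub>G\<^esub> x)"

definition borel_sets_of :: "'a topology \<Rightarrow> 'a set set" where
  "borel_sets_of T = sigma_sets (topspace T) {U. openin T U}"

text \<open>Normalized Haar measure of a compact group: a probability measure on the carrier,
  defined (at least) on all Borel sets, invariant under left and right translations,
  and regular (outer regular by open sets, inner regular by compact sets).
  Its measurable sets may include more than the Borel sets (e.g. the completion).\<close>
definition normalized_haar_measure ::
    "('a, 'b) monoid_scheme \<Rightarrow> 'a topology \<Rightarrow> 'a measure \<Rightarrow> bool" where
  "normalized_haar_measure G T m \<longleftrightarrow>
     emeasure m (space m) = 1 \<and> space m = carrier G \<and> borel_sets_of T \<subseteq> sets m \<and>
     (\<forall>A \<in> sets m. \<forall>g \<in> carrier G.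
        g <#\<^bsub>G\<^esub> A \<in> sets m \<and> emeasure m (g <#\<^bsub>G\<^esub> A) = emeasure m A \<and>
        A #>\<^bsub>G\<^esub> g \<in> sets m \<and> emeasure m (A #>\<^bsub>G\<^esub> g) = emeasure m A) \<and>
     (\<forall>A \<in> sets m.
        emeasure m A = (INF U \<in> {U. openin T U \<and> A \<subseteq> U}. emeasure m U) \<and>
        emeasure m A = (SUP K \<in> {K. compactin T K \<and> K \<subseteq> A}. emeasure m K))"

end

theory Submission
  imports Defs
begin

text \<open>
  Inside the symmetric group of the carrier, identify \<open>G\<close> with its left translations and let \<open>t\<close> be
  the permutation \<open>\<alpha>\<close>; then \<open>x\<close> lies in \<open>X\<close> iff \<open>(x t)\<^sup>3 = 1\<close>, and since \<open>m(X) > 15/16\<close>, any 16 left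
  translates of \<open>X\<close> have a common point. If \<open>u\<close>, \<open>a u\<close> and \<open>a\<^sup>-\<^sup>1 u\<close> have order dividing 3, then \<open>a\<close> commutes
  with its conjugate by \<open>u\<close>; nine such conditions on one generic \<open>u\<close> in the coset \<open>G t\<close> make \<open>G\<close> a
  2-Engel group, hence nilpotent of class at most 3 (Levi). A homomorphism that is constant on
  generic arguments is trivial, so that \<open>g\<close> commutes with all conjugates of \<open>g\<^sup>\<alpha>\<close>, and the conjugates of
  \<open>g, g\<^sup>\<alpha>, g\<^sup>\<alpha>\<^sup>\<alpha>\<close> lie in one abelian subgroup. There the product \<open>g \<cdot> g\<^sup>b\<^sup>t \<cdot> g\<^sup>b\<^sup>t\<^sup>b\<^sup>t\<close> is a quadratic function
  of \<open>b\<close> that vanishes for generic \<open>b\<close>; its third difference over a generic cube with one vertex at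
  \<open>b = 1\<close> shows that it vanishes there too, which says that \<open>g \<in> X\<close>.
\<close>

section \<open>Conjugates and commutators\<close>

text \<open>The class \<open>group_add\<close> is not commutative; all groups are written additively.\<close>

definition conj_by :: "'g::group_add \<Rightarrow> 'g \<Rightarrow> 'g" where
  "conj_by x a = x + a - x"

definition commutator :: "'g::group_add \<Rightarrow> 'g \<Rightarrow> 'g" where
  "commutator x y = x + y - x - y"

text \<open>The complete rewriting system for groups: words are brought to freely reduced form, so
  \<open>simp only\<close> with it proves any identity valid in all groups.\<close>

lemmas word_simps = add.assoc diff_conv_add_uminus minus_add minus_minus left_minus right_minus
  add_minus_cancel minus_add_cancel add_0_left add_0_right minus_zero

lemma commute_uminus:
  fixes a b :: "'g::group_add"
  assumes "a + b = b + a"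
  shows "- a + b = b - a"
proof -
  have "- a + (b + a) + - a = - a + (a + b) + - a" using assms by simp
  then show ?thesis by (simp only: word_simps)
qed

lemma conj_by_add: "conj_by (x + y) a = conj_by x (conj_by y a)"
  unfolding conj_by_def by (simp only: word_simps)

lemma conj_by_plus: "conj_by x (a + b) = conj_by x a + conj_by x b"
  unfolding conj_by_def by (simp only: word_simps)

lemma conj_by_uminus: "conj_by x (- a) = - conj_by x a"
  unfolding conj_by_def by (simp only: word_simps)

lemma conj_by_0 [simp]: "conj_by x 0 = 0" "conj_by 0 a = a"
  unfolding conj_by_def by simp_all

lemma conj_by_diff: "conj_by x (a - b) = conj_by x a - conj_by x b"
  unfolding conj_by_def by (simp only: word_simps)

lemma commutator_conj: "commutator x a = conj_by x a - a"
  unfolding conj_by_def commutator_def ..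

lemma minus_commutator: "- commutator x y = commutator y x"
  unfolding commutator_def by (simp only: word_simps)

lemma commutator_eq_0_iff: "commutator x y = 0 \<longleftrightarrow> x + y = y + x"
  unfolding commutator_def by (simp add: diff_eq_eq)

lemma commutator_add_left:
  "commutator (x + y) a = commutator x (commutator y a) + commutator y a + commutator x a"
  unfolding commutator_def by (simp only: word_simps)

lemma commutator_add_right:
  "commutator x (a + b) = commutator x a + conj_by a (commutator x b)"
  unfolding commutator_def conj_by_def by (simp only: word_simps)

lemma conj_by_eq_self_iff: "conj_by x a = a \<longleftrightarrow> commutator x a = 0"
  unfolding commutator_conj by simp

lemma conj_by_cancel: "conj_by x a = conj_by x b \<longleftrightarrow> a = b"
  unfolding conj_by_def by (metis add_left_cancel diff_add_cancel)

lemma conj_by_commutator: "conj_by x a = commutator x a + a"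
  unfolding commutator_conj by simp

lemma conj_commute_of_commute:
  assumes "a + conj_by (- x + y) b = conj_by (- x + y) b + a"
  shows "conj_by x a + conj_by y b = conj_by y b + conj_by x a"
proof -
  have "conj_by x (a + conj_by (- x + y) b) = conj_by x (conj_by (- x + y) b + a)"
    by (rule arg_cong[OF assms])
  then show ?thesis unfolding conj_by_plus conj_by_add[symmetric] by (simp only: word_simps)
qed

section \<open>Elements of order dividing 3 in a coset\<close>

definition order3 :: "'g::group_add \<Rightarrow> bool" where
  "order3 u \<longleftrightarrow> u + u + u = 0"

text \<open>Moving the three copies of \<open>u\<close> in the cube of \<open>a + u\<close> to the
  right leaves the norm of \<open>a\<close> under conjugation by \<open>u\<close>, followed by the
  trivial cube of \<open>u\<close>.\<close>

lemma order3_add_iff: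
  assumes "order3 u"
  shows "order3 (a + u) \<longleftrightarrow> a + conj_by u a + conj_by (u + u) a = 0"
proof -
  have "- u + - u = u"
    using assms unfolding order3_def by (metis minus_add minus_unique)
  then have "a + conj_by u a + conj_by (u + u) a = (a + u) + (a + u) + (a + u)"
    unfolding conj_by_def by (simp only: word_simps)
  then show ?thesis by (simp add: order3_def)
qed

lemmas order3_norm = order3_add_iff[THEN iffD1]

text \<open>Inverting the norm of \<open>- a\<close> gives the norm of \<open>a\<close> with its
  factors reversed, so \<open>a + ?a'\<close> and \<open>?a' + a\<close> are both inverse to
  \<open>?a''\<close>.\<close>

lemma order3_conj_commute:
  assumes "order3 u" "order3 (a + u)" "order3 (- a + u)"
  shows "a + conj_by u a = conj_by u a + a"
proof -
  let ?a' = "conj_by u a" and ?a'' = "conj_by (u + u) a"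
  have 1: "a + ?a' + ?a'' = 0" using order3_norm[OF assms(1,2)] .
  have "- a + conj_by u (- a) + conj_by (u + u) (- a) = 0" using order3_norm[OF assms(1,3)] .
  then have "- a - ?a' - ?a'' = 0" unfolding conj_by_def by (simp only: word_simps)
  then have "- (?a'' + (?a' + a)) = 0" by (simp only: word_simps)
  then have "?a'' + (?a' + a) = 0" by simp
  with 1 show ?thesis by (metis minus_unique add.inverse_inverse)
qed

text \<open>The norms of \<open>z\<close> under \<open>w\<close>, \<open>k + w\<close> and
  \<open>- k + w\<close> all vanish. Eliminating \<open>z''\<close> from these relations computes
  the conjugate by \<open>k'\<close> of the commutator \<open>d\<close> of \<open>z\<close> and
  \<open>k\<close>. But \<open>k'\<close> commutes with \<open>k\<close> and with
  \<open>conj_by z k\<close>, hence fixes \<open>d\<close>; comparing both values gives the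
  claim.\<close>

lemma engel_of_order3:
  fixes k z w :: "'g::group_add"
  assumes "\<And>f. f \<in> {0, z, - z, k, - k, z + k, z - k, k - z, - k - z} \<Longrightarrow> order3 (f + w)"
  shows "k + conj_by z k = conj_by z k + k"
proof -
  have o: "order3 w" "order3 (z + w)" "order3 (- z + w)" "order3 (k + w)" "order3 (- k + w)"
    "order3 (z + (k + w))" "order3 (z + (- k + w))" "order3 (k + (- z + w))" "order3 (- k + (- z + w))"
    using assms[of 0] assms[of z] assms[of "- z"] assms[of k] assms[of "- k"] assms[of "z + k"]
      assms[of "z - k"] assms[of "k - z"] assms[of "- k - z"]
    by (simp_all only: insert_iff simp_thms word_simps)
  define z' z'' k' where "z' = conj_by w z" and "z'' = conj_by (w + w) z" and "k' = conj_by w k"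
  have n0: "z + z' + z'' = 0"
    using order3_norm[OF o(1,2)] unfolding z'_def z''_def .
  \<comment> \<open>Conjugating the norm for \<open>k + w\<close> by \<open>- k\<close> makes its
    middle term the \<open>z'\<close> of \<open>n0\<close>; the last term uses
    \<open>w + k + w = k' + w + w\<close>. For \<open>n2\<close>, \<open>k\<close> is replaced by
    \<open>- k\<close>.\<close>
  have n1: "conj_by (- k) z + z' + conj_by k' z'' = 0"
  proof -
    have "conj_by (- k) z + z' + conj_by k' z''
        = conj_by (- k) (z + conj_by (k + w) z + conj_by (k + w + (k + w)) z)"
      unfolding z'_def z''_def k'_def conj_by_def by (simp only: word_simps)
    then show ?thesis using order3_norm[OF o(4,6)] by simp
  qed
  have n2: "conj_by k z + z' + conj_by (- k') z'' = 0"
  proof -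
    have "conj_by k z + z' + conj_by (- k') z''
        = conj_by k (z + conj_by (- k + w) z + conj_by (- k + w + (- k + w)) z)"
      unfolding z'_def z''_def k'_def conj_by_def by (simp only: word_simps)
    then show ?thesis using order3_norm[OF o(5,7)] by simp
  qed
  have c1: "k + k' = k' + k"
    using order3_conj_commute[OF o(1,4,5)] unfolding k'_def .
  have "k + conj_by (- z + w) k = conj_by (- z + w) k + k"
    using order3_conj_commute[OF o(3,8,9)] .
  then have "k + conj_by (- z) k' = conj_by (- z) k' + k"
    unfolding conj_by_add k'_def .
  then have "conj_by z (k + conj_by (- z) k') = conj_by z (conj_by (- z) k' + k)" by simp
  then have c2: "conj_by z k + k' = k' + conj_by z k"
    unfolding conj_by_plus conj_by_add[symmetric] by simp
  \<comment> \<open>This form of the commutator suits the norm relations; the form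
    \<open>conj_by z k - k\<close> shows that \<open>k'\<close> fixes it.\<close>
  define d where "d = z - conj_by k z"
  have d: "d = conj_by z k - k" unfolding d_def conj_by_def by (simp only: word_simps)
  have fixed: "conj_by k' d = d"
  proof -
    have "k' + - k = - k + k'" using commute_uminus[OF c1] by simp
    then have "k' + d = d + k'" unfolding d diff_conv_add_uminus using c2 by (metis add.assoc)
    then show ?thesis unfolding conj_by_def by simp
  qed
  have e0: "z'' = - z' - z" using minus_unique[OF n0] by (simp add: minus_add)
  have e1: "conj_by k' z'' = - z' - conj_by (- k) z"
    using minus_unique[OF n1] by (simp add: minus_add)
  have "conj_by (- k') z'' = - z' - conj_by k z"
    using minus_unique[OF n2] by (simp add: minus_add)
  then have "conj_by k' (conj_by (- k') z'') = conj_by k' (- z' - conj_by k z)" by simp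
  then have e2: "z'' = conj_by k' (- z' - conj_by k z)"
    unfolding conj_by_add[symmetric] by simp
  have "conj_by k' d = - conj_by k' (- z' - z) + conj_by k' (- z' - conj_by k z)"
    unfolding d_def conj_by_uminus[symmetric] conj_by_plus[symmetric] by (simp only: word_simps)
  also have "\<dots> = - (- z' - conj_by (- k) z) + (- z' - z)"
    using arg_cong[OF e0, of "conj_by k'"] e1 e2 e0 by simp
  also have "\<dots> = conj_by (- k) z - z" by (simp only: word_simps)
  finally have "conj_by z k - k = conj_by (- k) z - z" using fixed d by simp
  then have "k + (conj_by z k - k) + k = k + (conj_by (- k) z - z) + k" by simp
  then show ?thesis unfolding conj_by_def by (simp only: word_simps)
qed

section \<open>Abelian subgroups and double centralizers\<close>

text \<open>The ambient type is not commutative, so associative-commutative rewriting has to be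
  restricted to members of \<open>A\<close>.\<close>

locale abelian_subgroup =
  fixes A :: "'g::group_add set"
  assumes zero_mem [simp]: "0 \<in> A"
    and add_mem [simp]: "a \<in> A \<Longrightarrow> b \<in> A \<Longrightarrow> a + b \<in> A"
    and minus_mem [simp]: "a \<in> A \<Longrightarrow> - a \<in> A"
    and commute: "a \<in> A \<Longrightarrow> b \<in> A \<Longrightarrow> a + b = b + a"
begin

lemma left_commute: "a \<in> A \<Longrightarrow> b \<in> A \<Longrightarrow> a + (b + c) = b + (a + c)"
  by (metis add.assoc commute)

lemmas ac = add.assoc commute left_commute

lemma diff_mem [simp]: "a \<in> A \<Longrightarrow> b \<in> A \<Longrightarrow> a - b \<in> A"
  by (metis add_mem minus_mem diff_conv_add_uminus)

end

definition centralizer :: "'g::group_add set \<Rightarrow> 'g set" where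
  "centralizer D = {y. \<forall>d\<in>D. y + d = d + y}"

lemma subset_double_centralizer: "D \<subseteq> centralizer (centralizer D)"
  unfolding centralizer_def by auto

lemma centralizer_minus:
  assumes "y \<in> centralizer D" shows "- y \<in> centralizer D"
  using assms commute_uminus unfolding centralizer_def by auto

text \<open>Taking centralizers reverses inclusions: \<open>D\<close> lies in its centralizer, so
  the double centralizer does too, and its members commute with each other. It serves as an abelian
  subgroup around \<open>D\<close> without any induction over generated elements.\<close>

lemma abelian_subgroup_double_centralizer:
  assumes "\<And>a b. a \<in> D \<Longrightarrow> b \<in> D \<Longrightarrow> a + b = b + a"
  shows "abelian_subgroup (centralizer (centralizer D))"
proof
  have "D \<subseteq> centralizer D" using assms unfolding centralizer_def by auto
  then have "centralizer (centralizer D) \<subseteq> centralizer D"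
    unfolding centralizer_def by auto
  then show "a + b = b + a"
    if "a \<in> centralizer (centralizer D)" "b \<in> centralizer (centralizer D)" for a b
    using that unfolding centralizer_def[of "centralizer D"] by auto
  show "a + b \<in> centralizer (centralizer D)"
    if "a \<in> centralizer (centralizer D)" "b \<in> centralizer (centralizer D)" for a b
    using that unfolding centralizer_def[of "centralizer D"] mem_Collect_eq by (metis add.assoc)
qed (auto simp: centralizer_minus, simp add: centralizer_def)

section \<open>Levi's theorem on 2-Engel groups\<close>

locale engel_subgroup =
  fixes H :: "'g::group_add set"
  assumes zero_mem [simp]: "0 \<in> H"
    and add_mem [simp]: "x \<in> H \<Longrightarrow> y \<in> H \<Longrightarrow> x + y \<in> H"
    and minus_mem [simp]: "x \<in> H \<Longrightarrow> - x \<in> H"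
    and engel: "x \<in> H \<Longrightarrow> y \<in> H \<Longrightarrow> x + conj_by y x = conj_by y x + x"
begin

lemma conj_mem [simp]: "x \<in> H \<Longrightarrow> y \<in> H \<Longrightarrow> conj_by x y \<in> H"
  unfolding conj_by_def by (metis add_mem minus_mem diff_conv_add_uminus)

lemma commutator_mem [simp]: "x \<in> H \<Longrightarrow> y \<in> H \<Longrightarrow> commutator x y \<in> H"
  unfolding commutator_def by (metis add_mem minus_mem diff_conv_add_uminus)

text \<open>So the conjugates of \<open>a\<close> generate an abelian subgroup on which
  \<open>H\<close> acts, and the next identities can be read in its endomorphism ring.\<close>

lemma conjugates_commute:
  assumes "a \<in> H" "x \<in> H" "y \<in> H"
  shows "conj_by x a + conj_by y a = conj_by y a + conj_by x a"
  by (rule conj_commute_of_commute, rule engel) (use assms in simp_all)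

text \<open>As operators on the conjugates of \<open>a\<close>, \<open>x\<close> and its inverse
  have sum 2, that is, \<open>x - 1\<close> has square zero. The proof rewrites the left side so
  that the Engel law swaps two factors in each bracket.\<close>

lemma conj_add_conj_minus:
  assumes "a \<in> H" "x \<in> H"
  shows "conj_by x a + conj_by (- x) a = a + a"
proof -
  have 1: "- x + conj_by (- a) x = conj_by (- a) x - x"
    by (rule commute_uminus, rule engel) (use assms in simp_all)
  have 2: "conj_by (- x) a - a = - a + conj_by (- x) a"
    by (rule commute_uminus[symmetric], rule engel) (use assms in simp_all)
  have "conj_by x a + conj_by (- x) a = a + (conj_by (- a) x - x) + (conj_by (- x) a - a) + a"
    unfolding conj_by_def by (simp only: word_simps)
  also have "\<dots> = a + (- x + conj_by (- a) x) + (- a + conj_by (- x) a) + a"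
    using 1 2 by simp
  also have "\<dots> = a + a" unfolding conj_by_def by (simp only: word_simps)
  finally show ?thesis .
qed

lemma commutator_minus_right:
  assumes "x \<in> H" "a \<in> H"
  shows "commutator x (- a) = - commutator x a"
proof -
  have "commutator x (- a) = - conj_by x a + a"
    unfolding commutator_conj conj_by_uminus by simp
  moreover have "- commutator x a = a - conj_by x a" unfolding commutator_conj by simp
  moreover have "- conj_by x a + a = a - conj_by x a"
    using commute_uminus[OF engel[OF assms(2,1), symmetric]] .
  ultimately show ?thesis by simp
qed

lemma commutator_minus_left:
  assumes "x \<in> H" "a \<in> H"
  shows "commutator (- x) a = - commutator x a"
  using commutator_minus_right[of a x] assms minus_commutator by metis

lemma commutator_self_left:
  assumes "x \<in> H" "a \<in> H" shows "commutator x (commutator x a) = 0"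
proof -
  have "x + - conj_by a x = - conj_by a x + x"
    using commute_uminus[OF engel[OF assms, symmetric]] by simp
  then have "x + (x - conj_by a x) = (x - conj_by a x) + x"
    by (metis add.assoc diff_conv_add_uminus)
  moreover have "commutator x a = x - conj_by a x"
    unfolding commutator_def conj_by_def by (simp only: word_simps)
  ultimately show ?thesis by (simp add: commutator_eq_0_iff)
qed

text \<open>In operator notation, the previous lemma is used for \<open>xy\<close>, for
  \<open>x\<close>, for \<open>y\<close> acting on the inverse of \<open>x\<close>, and for
  \<open>x\<close> with \<open>y\<close> applied to the result. Eliminating inverses yields
  \<open>xy + yx + 2 = 2x + 2y\<close>, which says that \<open>x - 1\<close> and
  \<open>y - 1\<close> anticommute; hence \<open>xy - yx\<close> is twice their product.\<close>

lemma double_commutator_expand: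
  assumes "a \<in> H" "x \<in> H" "y \<in> H"
  shows "commutator x (commutator y a) + commutator y (commutator x a) = 0"
    and "conj_by (x + y) a - conj_by (y + x) a
      = commutator x (commutator y a) + commutator x (commutator y a)"
proof -
  let ?D = "(\<lambda>x. conj_by x a) ` H"
  define A where "A = centralizer (centralizer ?D)"
  interpret A: abelian_subgroup A
    unfolding A_def
    by (rule abelian_subgroup_double_centralizer) (use assms conjugates_commute in auto)
  have mem: "conj_by x a \<in> A" if "x \<in> H" for x
    using subset_double_centralizer[of ?D] that unfolding A_def by blast
  define p q s r b e d where "p = conj_by x a" and "q = conj_by y a" and "s = conj_by (x + y) a"
    and "r = conj_by (y + x) a" and "b = conj_by (- x) a" and "e = conj_by (- (x + y)) a"
    and "d = conj_by (y - x) a"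
  note defs = p_def q_def s_def r_def b_def e_def d_def
  have [simp]: "a \<in> A" using mem[of 0] by simp
  have [simp]: "p \<in> A" "q \<in> A" "s \<in> A" "r \<in> A" "b \<in> A" "e \<in> A" "d \<in> A"
    unfolding defs using assms by (auto intro!: mem simp del: add_uminus_conv_diff simp: diff_conv_add_uminus)
  have 1: "s + e = a + a"
    unfolding defs using conj_add_conj_minus[of a "x + y"] assms by simp
  have 2: "d + e = b + b"
  proof -
    have "conj_by (- y) b = e" unfolding defs conj_by_def by (simp only: word_simps)
    moreover have "conj_by y b = d" unfolding defs conj_by_def by (simp only: word_simps)
    moreover have "b \<in> H" unfolding b_def using assms by simp
    ultimately show ?thesis using conj_add_conj_minus[of b y] assms by simp
  qed
  have 3: "p + b = a + a" unfolding defs using conj_add_conj_minus[of a x] assms by simp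
  have 4: "r + d = q + q"
  proof -
    have "r + d = conj_by y (p + b)" unfolding defs conj_by_def by (simp only: word_simps)
    also have "\<dots> = q + q" unfolding 3 unfolding defs conj_by_plus ..
    finally show ?thesis .
  qed
  \<comment> \<open>Adding \<open>e + d\<close> to both sides lets relations 1 to 4 be applied
    without subtraction; it is cancelled at the end.\<close>
  have "(s + r + a + a) + (e + d) = (s + e) + (r + d) + (a + a)" by (simp add: A.ac)
  also have "\<dots> = (q + q) + ((a + a) + (a + a))" unfolding 1 4 by (simp add: A.ac)
  also have "\<dots> = (q + q) + ((p + b) + (p + b))" unfolding 3 ..
  also have "\<dots> = (p + p + q + q) + (b + b)" by (simp add: A.ac)
  also have "\<dots> = (p + p + q + q) + (e + d)" unfolding 2[symmetric] by (simp add: A.ac)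
  finally have key: "s + r + a + a = p + p + q + q" by simp
  have xy: "commutator x (commutator y a) = s - p - (q - a)"
    unfolding commutator_conj conj_by_diff defs conj_by_add ..
  have yx: "commutator y (commutator x a) = r - q - (p - a)"
    unfolding commutator_conj conj_by_diff defs conj_by_add ..
  have "commutator x (commutator y a) + commutator y (commutator x a)
      = (s + r + a + a) + - (p + p + q + q)"
    unfolding xy yx by (simp add: A.ac minus_add diff_conv_add_uminus del: add_uminus_conv_diff)
  then show z: "commutator x (commutator y a) + commutator y (commutator x a) = 0"
    unfolding key by simp
  have yx': "commutator y (commutator x a) = - commutator x (commutator y a)"
    using z by (metis minus_unique)
  have "(q - a) + p = (p - a) + q"
    by (simp add: A.ac diff_conv_add_uminus del: add_uminus_conv_diff)
  moreover have "s - r = commutator x (commutator y a) + ((q - a) + p)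
      + - ((p - a) + q) + - commutator y (commutator x a)"
    unfolding xy yx by (simp only: word_simps)
  ultimately have "s - r = commutator x (commutator y a) + commutator x (commutator y a)"
    unfolding yx' by (simp only: word_simps)
  then show "conj_by (x + y) a - conj_by (y + x) a
      = commutator x (commutator y a) + commutator x (commutator y a)"
    unfolding defs .
qed

lemma double_commutator_swap_left:
  assumes "a \<in> H" "x \<in> H" "y \<in> H"
  shows "commutator x (commutator y a) = - commutator y (commutator x a)"
  using double_commutator_expand(1)[OF assms] by (simp add: eq_neg_iff_add_eq_0)

lemma double_commutator_swap_right:
  assumes "a \<in> H" "x \<in> H" "y \<in> H"
  shows "commutator x (commutator y a) = - commutator x (commutator a y)"
  using commutator_minus_right[of x "commutator a y"] assms by (simp add: minus_commutator)

text \<open>A 3-cycle is a product of two adjacent transpositions, each of which changes the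
  sign.\<close>

lemma double_commutator_cycle:
  assumes "a \<in> H" "x \<in> H" "y \<in> H"
  shows "commutator x (commutator y a) = commutator a (commutator x y)"
  using double_commutator_swap_right[of a x y] double_commutator_swap_left[of y x a] assms by simp

text \<open>Conjugation by \<open>x\<close> and by \<open>y\<close> fixes \<open>p\<close>, so the
  expansion of the conjugates of \<open>a\<close> by \<open>x + y\<close> and \<open>y + x\<close>
  gives \<open>commutator (commutator x y) a = p + p\<close>. The cyclic identity gives
  \<open>- p\<close> for the same commutator.\<close>

lemma double_commutator_cube:
  assumes "a \<in> H" "x \<in> H" "y \<in> H"
  defines "p \<equiv> commutator x (commutator y a)"
  shows "p + p + p = 0"
proof -
  have "commutator x p = 0"
    unfolding p_def using commutator_self_left assms(1-3) by simp
  then have x: "conj_by x p = p" by (simp add: conj_by_eq_self_iff)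
  have "commutator y p = - commutator y (commutator y (commutator x a))"
    unfolding p_def using double_commutator_swap_left[OF assms(1-3)] commutator_minus_right assms(1-3) by simp
  then have "commutator y p = 0" using commutator_self_left assms(1-3) by simp
  then have y: "conj_by y p = p" by (simp add: conj_by_eq_self_iff)
  \<comment> \<open>Negating both arguments leaves \<open>commutator x y\<close> unchanged, and in
    this form the next equality holds in every group.\<close>
  have "conj_by (y + x) (commutator (commutator x y) a)
      = conj_by (y + x) (commutator (commutator (- x) (- y)) a)"
    using commutator_minus_left commutator_minus_right assms(1-3) by simp
  also have "\<dots> = conj_by (x + y) a - conj_by (y + x) a"
    unfolding conj_by_def commutator_def by (simp only: word_simps)
  also have "\<dots> = p + p" using double_commutator_expand(2)[OF assms(1-3)] unfolding p_def .
  also have "\<dots> = conj_by (y + x) (p + p)" unfolding conj_by_plus conj_by_add x y ..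
  finally have "commutator (commutator x y) a = p + p" by (simp only: conj_by_cancel)
  moreover have "commutator (commutator x y) a = - p"
    using double_commutator_cycle[OF assms(1-3)] minus_commutator unfolding p_def by metis
  ultimately show ?thesis by (metis left_minus)
qed

text \<open>The triple commutator is alternating in its four arguments, and the cyclic identity applied to
  two commutators shows that the even permutation \<open>(x y z w) \<mapsto> (z w x y)\<close> changes its sign: it is killed
  by 2, and by 3.\<close>

theorem triple_commutator_eq_0:
  assumes "x \<in> H" "y \<in> H" "z \<in> H" "w \<in> H"
  shows "commutator x (commutator y (commutator z w)) = 0"
proof -
  define q where "q x y z w = commutator x (commutator y (commutator z w))" for x y z w :: 'g
  have s12: "q x y z w = - q y x z w" if "x \<in> H" "y \<in> H" "z \<in> H" "w \<in> H" for x y z w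
    unfolding q_def by (rule double_commutator_swap_left) (use that in simp_all)
  have s23: "q x y z w = - q x z y w" if "x \<in> H" "y \<in> H" "z \<in> H" "w \<in> H" for x y z w
    unfolding q_def double_commutator_swap_left[OF that(4,2,3)]
    by (rule commutator_minus_right) (use that in simp_all)
  have s34: "q x y z w = - q x y w z" if "x \<in> H" "y \<in> H" "z \<in> H" "w \<in> H" for x y z w
    unfolding q_def double_commutator_swap_right[OF that(4,2,3)]
    by (rule commutator_minus_right) (use that in simp_all)
  have "q x y z w = commutator (commutator z w) (commutator x y)"
    unfolding q_def by (rule double_commutator_cycle) (use assms in simp_all)
  also have "\<dots> = - commutator (commutator x y) (commutator z w)"
    by (simp add: minus_commutator)
  also have "\<dots> = - q z w x y"
    unfolding q_def by (subst double_commutator_cycle[of "commutator x y" z w]) (use assms in simp_all)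
  also have "q z w x y = q x y z w"
    by (simp only: s23[of z w x y] s12[of z x w y] s34[of x z w y] s23[of x z y w] assms minus_minus)
  finally have "q x y z w + q x y z w = 0" by (metis left_minus)
  moreover have "q x y z w + q x y z w + q x y z w = 0"
    unfolding q_def using double_commutator_cube assms by simp
  ultimately show ?thesis unfolding q_def by simp
qed

lemma double_commutator_central:
  assumes "x \<in> H" "y \<in> H" "a \<in> H" "w \<in> H"
  shows "w + commutator x (commutator y a) = commutator x (commutator y a) + w"
  using triple_commutator_eq_0[of w x y a] assms by (simp add: commutator_eq_0_iff)

text \<open>The correction term of the expansion is a triple commutator, hence zero. With the next
  lemma this makes the double commutator additive in its first two arguments.\<close>

lemma double_commutator_add_left:
  assumes "x \<in> H" "y \<in> H" "z \<in> H" "a \<in> H"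
  shows "commutator (x + y) (commutator z a)
    = commutator x (commutator z a) + commutator y (commutator z a)"
  unfolding commutator_add_left[of x y]
  using triple_commutator_eq_0[of x y z a] double_commutator_central[of x z a "commutator y (commutator z a)"] assms
  by simp

lemma double_commutator_add_middle:
  assumes "x \<in> H" "y \<in> H" "z \<in> H" "a \<in> H"
  shows "commutator x (commutator (y + z) a)
    = commutator x (commutator y a) + commutator x (commutator z a)"
proof -
  have c: "conj_by u (commutator x (commutator v a)) = commutator x (commutator v a)"
    if "u \<in> H" "v \<in> H" for u v
    using triple_commutator_eq_0[of u x v a] assms that by (simp add: conj_by_eq_self_iff)
  have "commutator x (commutator (y + z) a)
      = commutator x (commutator z a) + commutator x (commutator y a)"
    unfolding commutator_add_left[of y z] commutator_add_right
    using triple_commutator_eq_0[of x y z a] assms c by (simp add: conj_by_add)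
  then show ?thesis
    using double_commutator_central[of x y a "commutator x (commutator z a)"] assms by simp
qed

end

section \<open>Quadratic functions and generic elements of a coset\<close>

text \<open>Both sides contain each of \<open>T x y\<close>, \<open>T x z\<close>,
  \<open>T y z\<close> once. This is the alternating sum over a cube whose vertex at 0 is omitted;
  in the applications \<open>e\<close> vanishes there.\<close>

lemma (in abelian_subgroup) quadratic_third_difference:
  assumes e: "\<And>x. x \<in> H \<Longrightarrow> e x \<in> A" and T: "\<And>x y. x \<in> H \<Longrightarrow> y \<in> H \<Longrightarrow> T x y \<in> A"
    and H: "\<And>x y. x \<in> H \<Longrightarrow> y \<in> H \<Longrightarrow> x + y \<in> H"
    and e_add: "\<And>x y. x \<in> H \<Longrightarrow> y \<in> H \<Longrightarrow> e (x + y) = e x + e y + T x y"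
    and T_add: "\<And>x y z. x \<in> H \<Longrightarrow> y \<in> H \<Longrightarrow> z \<in> H \<Longrightarrow> T (x + y) z = T x z + T y z"
    and "x \<in> H" "y \<in> H" "z \<in> H"
  shows "e (x + y + z) + e x + e y + e z = e (x + y) + e (x + z) + e (y + z)"
proof -
  have "e (x + y + z) = e x + e y + T x y + e z + (T x z + T y z)"
    using e_add[of "x + y" z] assms by simp
  then show ?thesis using e_add[of x y] e_add[of x z] e_add[of y z] assms by (simp add: ac)
qed

text \<open>The algebra sees the measure only through \<open>generic\<close>: up to 16 conditions on
  one element \<open>b + t\<close> of the coset can be met together.\<close>

locale generic_order3_coset =
  fixes H :: "'g::group_add set" and t :: 'g
  assumes zero_mem: "0 \<in> H"
    and add_mem: "x \<in> H \<Longrightarrow> y \<in> H \<Longrightarrow> x + y \<in> H"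
    and minus_mem: "x \<in> H \<Longrightarrow> - x \<in> H"
    and order3_t: "order3 t"
    and conj_t_mem [simp]: "x \<in> H \<Longrightarrow> conj_by t x \<in> H"
    and generic: "set xs \<subseteq> H \<Longrightarrow> length xs \<le> 16 \<Longrightarrow> \<exists>b\<in>H. \<forall>f\<in>set xs. order3 (f + (b + t))"
begin

text \<open>One generic \<open>w = b + t\<close> meets the nine conditions of
  \<open>engel_of_order3\<close>.\<close>

sublocale engel_subgroup H
proof
  fix k z assume kz: "k \<in> H" "z \<in> H"
  let ?F = "[0, z, - z, k, - k, z + k, z - k, k - z, - k - z]"
  have "set ?F \<subseteq> H"
    using kz zero_mem add_mem minus_mem
    by (simp del: add_uminus_conv_diff add: diff_conv_add_uminus)
  then obtain b where "\<forall>f\<in>set ?F. order3 (f + (b + t))" using generic[of ?F] by auto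
  then show "k + conj_by z k = conj_by z k + k"
    by (intro engel_of_order3[of z k "b + t"]) auto
qed (rule zero_mem, erule (1) add_mem, erule minus_mem)

text \<open>For generic \<open>b\<close>, \<open>g\<close> commutes with
  \<open>conj_by b g'\<close>, which forces \<open>f b = - c\<close>. As \<open>f\<close> is
  additive, comparing two generic arguments \<open>b\<close> and \<open>h + b\<close> gives
  \<open>f h = 0\<close> for every \<open>h\<close>; then \<open>c = 0\<close> too, and
  \<open>expand\<close> finishes.\<close>

lemma conj_t_commute:
  assumes "g \<in> H" "h \<in> H"
  shows "g + conj_by h (conj_by t g) = conj_by h (conj_by t g) + g"
proof -
  define g' where "g' = conj_by t g"
  define c where "c = commutator g g'"
  define f where "f b = commutator g (commutator b g')" for b
  have [simp]: "g' \<in> H" "g \<in> H" "h \<in> H" unfolding g'_def using assms by simp_all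
  have expand: "commutator g (conj_by b g') = f b + conj_by (commutator b g') c" for b
    unfolding f_def c_def conj_by_commutator[of b g'] commutator_add_right ..
  have f_eq: "f b = - c"
    if b: "b \<in> H" and o: "order3 (b + t)" "order3 (g + (b + t))" "order3 (- g + (b + t))" for b
  proof -
    have "g + conj_by b g' = conj_by b g' + g"
      using order3_conj_commute[OF o] unfolding g'_def conj_by_add .
    then have "f b + conj_by (commutator b g') c = 0"
      unfolding expand[symmetric] by (simp add: commutator_eq_0_iff)
    from minus_unique[OF this] have 1: "conj_by (commutator b g') c = - f b" by simp
    \<comment> \<open>Triple commutators vanish, so the conjugation in 1 fixes \<open>f b\<close>
      and can be stripped from \<open>c\<close>.\<close>
    have "commutator (commutator b g') (f b) = 0"
      unfolding f_def using triple_commutator_eq_0 b by simp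
    then have "conj_by (commutator b g') (f b) = f b" by (simp only: conj_by_eq_self_iff)
    with 1 have "conj_by (commutator b g') c = conj_by (commutator b g') (- f b)"
      by (simp only: conj_by_uminus)
    then have "c = - f b" by (simp only: conj_by_cancel)
    then show ?thesis by simp
  qed
  have f_add: "\<exists>b\<in>H. f b = - c \<and> f h = 0" if h [simp]: "h \<in> H" for h
  proof -
    \<comment> \<open>The first three entries make \<open>b\<close> generic for \<open>f_eq\<close>,
      the last three \<open>h + b\<close>.\<close>
    have "\<exists>b\<in>H. \<forall>f\<in>set [0, g, - g, h, g + h, - g + h]. order3 (f + (b + t))"
      by (rule generic) simp_all
    then obtain b where b: "b \<in> H"
      and o: "order3 (b + t)" "order3 (g + (b + t))" "order3 (- g + (b + t))" "order3 (h + (b + t))"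
        "order3 (g + h + (b + t))" "order3 (- g + h + (b + t))" by auto
    have fb: "f b = - c"
      using f_eq[of b] b o by simp
    have "f (h + b) = - c"
      using f_eq[of "h + b"] b o by (simp add: add.assoc)
    moreover have "f (h + b) = f h + f b"
      unfolding f_def using double_commutator_add_middle b by simp
    ultimately have "f h + - c = 0 + - c" using fb by simp
    then have "f h = 0" by (simp only: add_right_cancel)
    then show ?thesis using fb b by blast
  qed
  obtain b where "b \<in> H" "f b = - c" "f h = 0" using f_add[of h] by auto
  moreover have "f b = 0" using f_add[of b] \<open>b \<in> H\<close> by auto
  ultimately have "commutator g (conj_by h g') = 0" using expand[of h] by simp
  then show ?thesis unfolding g'_def by (simp add: commutator_eq_0_iff)
qed

text \<open>For generic \<open>x\<close>, \<open>M x\<close> is the norm of \<open>g\<close> under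
  \<open>x + t\<close>, so it vanishes; \<open>M 0\<close> is the norm under \<open>t\<close>, whose
  vanishing is the claim. As \<open>M\<close> is a constant plus quadratic functions with values in
  \<open>A\<close>, \<open>M 0\<close> is determined by the other seven vertices of a cube.\<close>

theorem order3_coset:
  assumes "g \<in> H"
  shows "order3 (g + t)"
proof -
  define g' g'' where "g' = conj_by t g" and "g'' = conj_by t g'"
  have mem [simp]: "g \<in> H" "g' \<in> H" "g'' \<in> H" unfolding g'_def g''_def using assms by simp_all
  have "t + t + t = 0" using order3_t unfolding order3_def .
  then have g: "conj_by t g'' = g"
    unfolding g''_def g'_def conj_by_add[symmetric] by (simp add: add.assoc)
  \<comment> \<open>One instance for each step of the cycle from \<open>g\<close> to
    \<open>g'\<close> to \<open>g''\<close> and back to \<open>g\<close>.\<close>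
  note c = conj_t_commute[OF mem(1), folded g'_def] conj_t_commute[OF mem(2), folded g''_def]
    conj_t_commute[OF mem(3), unfolded g]
  define D where "D = {conj_by x a | x a. x \<in> H \<and> a \<in> {g, g', g''}}"
  define A where "A = centralizer (centralizer D)"
  interpret A: abelian_subgroup A
    unfolding A_def
  proof (rule abelian_subgroup_double_centralizer)
    fix u v assume "u \<in> D" "v \<in> D"
    then obtain x y a b where uv: "u = conj_by x a" "v = conj_by y b" and xy [simp]: "x \<in> H" "y \<in> H"
      and ab: "a \<in> {g, g', g''}" "b \<in> {g, g', g''}" unfolding D_def by blast
    have *: "conj_by x g + conj_by y g' = conj_by y g' + conj_by x g"
      "conj_by x g' + conj_by y g'' = conj_by y g'' + conj_by x g'"
      "conj_by x g'' + conj_by y g = conj_by y g + conj_by x g''" if "x \<in> H" "y \<in> H" for x y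
      by (rule conj_commute_of_commute, rule c, use that in simp)+
    show "u + v = v + u"
      using ab unfolding uv by (auto intro: * *[symmetric] conjugates_commute)
  qed
  have conj_A: "conj_by x a \<in> A" if "x \<in> H" "a \<in> {g, g', g''}" for x a
    using subset_double_centralizer[of D] that unfolding A_def D_def by blast
  have A_mem [simp]: "a \<in> A" if "a \<in> {g, g', g''}" for a
    using conj_A[of 0 a] that by simp
  have e_A: "commutator x a \<in> A" if "x \<in> H" "a \<in> {g, g', g''}" for x a
    unfolding commutator_conj using conj_A that by simp
  have T_A: "commutator x (commutator y a) \<in> A" if "x \<in> H" "y \<in> H" "a \<in> {g, g', g''}" for x y a
    unfolding commutator_conj conj_by_diff conj_by_add[symmetric] using conj_A that by simp
  have e_add: "commutator (x + y) a = commutator x a + commutator y a + commutator x (commutator y a)"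
    if "x \<in> H" "y \<in> H" "a \<in> {g, g', g''}" for x y a
    unfolding commutator_add_left using e_A[of x a] e_A[of y a] T_A[of x y a] that by (simp add: A.ac)

  define \<tau> where "\<tau> x = conj_by t x" for x
  have \<tau> [simp]: "x \<in> H \<Longrightarrow> \<tau> x \<in> H" and \<tau>_add: "\<tau> (x + y) = \<tau> x + \<tau> y" for x y
    unfolding \<tau>_def conj_by_plus by simp_all
  define e1 where "e1 x = commutator x g'" for x
  \<comment> \<open>The argument \<open>x + \<tau> x\<close> comes from
    \<open>(x + t) + (x + t) = x + \<tau> x + t + t\<close>.\<close>
  define e2 where "e2 x = commutator (x + \<tau> x) g''" for x
  have cube1: "e1 (x + y + z) + e1 x + e1 y + e1 z = e1 (x + y) + e1 (x + z) + e1 (y + z)"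
    if "x \<in> H" "y \<in> H" "z \<in> H" for x y z
    by (rule A.quadratic_third_difference[where H = H and T = "\<lambda>x y. commutator x (commutator y g')"])
      (use that in \<open>simp_all add: e1_def e_A T_A e_add double_commutator_add_left\<close>)
  define T where "T x y = commutator x (commutator y g'')" for x y
  have T [simp]: "T x y \<in> A" if "x \<in> H" "y \<in> H" for x y
    unfolding T_def using that by (simp add: T_A)
  have T_add [simp]: "T (x + z) y = T x y + T z y" "T x (y + z) = T x y + T x z"
    if "x \<in> H" "y \<in> H" "z \<in> H" for x y z
    unfolding T_def using that by (simp_all add: double_commutator_add_left double_commutator_add_middle)
  have e2_A: "e2 x \<in> A" if "x \<in> H" for x unfolding e2_def using e_A that by simp
  \<comment> \<open>In \<open>T y (\<tau> x)\<close> the variable \<open>y\<close> stands first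
    because it precedes \<open>\<tau> x\<close> in the sum
    \<open>(x + y) + (\<tau> x + \<tau> y)\<close>.\<close>
  have e2_add: "e2 (x + y) = e2 x + e2 y + (T x y + T x (\<tau> y) + T y (\<tau> x) + T (\<tau> x) (\<tau> y))"
    if [simp]: "x \<in> H" "y \<in> H" for x y
  proof -
    define e where "e x = commutator x g''" for x
    have [simp]: "e x \<in> A" if "x \<in> H" for x
      unfolding e_def using that by (simp add: e_A)
    have [simp]: "e (x + y) = e x + e y + T x y" if "x \<in> H" "y \<in> H" for x y
      unfolding e_def T_def using that by (simp add: e_add)
    have "e2 (x + y) = e ((x + y) + (\<tau> x + \<tau> y))" "e2 x = e (x + \<tau> x)" "e2 y = e (y + \<tau> y)"
      unfolding e2_def e_def \<tau>_add by simp_all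
    then show ?thesis by (simp add: A.ac)
  qed
  have cube2: "e2 (x + y + z) + e2 x + e2 y + e2 z = e2 (x + y) + e2 (x + z) + e2 (y + z)"
    if "x \<in> H" "y \<in> H" "z \<in> H" for x y z
    by (rule A.quadratic_third_difference[where H = H and
          T = "\<lambda>x y. T x y + T x (\<tau> y) + T y (\<tau> x) + T (\<tau> x) (\<tau> y)"])
      (use that in \<open>simp_all add: e2_A e2_add \<tau>_add A.ac\<close>)

  define M where "M x = g + conj_by x g' + conj_by (x + \<tau> x) g''" for x
  have M: "M x = g + (e1 x + g') + (e2 x + g'')" for x
    unfolding M_def e1_def e2_def conj_by_commutator ..
  have e1_A: "e1 x \<in> A" if "x \<in> H" for x unfolding e1_def using e_A that by simp
  have M_cube: "M (x + y + z) + M x + M y + M z = M (x + y) + M (x + z) + M (y + z) + M 0"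
    if "x \<in> H" "y \<in> H" "z \<in> H" for x y z
  proof -
    \<comment> \<open>The constant term of \<open>M\<close>, equal to \<open>M 0\<close>; it occurs
      four times on each side.\<close>
    let ?k = "g + (g' + g'')"
    have "e1 0 = 0" "e2 0 = 0" unfolding e1_def e2_def \<tau>_def commutator_def by simp_all
    then have "M (x + y + z) + M x + M y + M z
        = (e1 (x + y + z) + e1 x + e1 y + e1 z) + (e2 (x + y + z) + e2 x + e2 y + e2 z) + (?k + ?k + ?k + ?k)"
      unfolding M using that e1_A e2_A by (simp add: A.ac)
    also have "\<dots> = (e1 (x + y) + e1 (x + z) + e1 (y + z)) + (e2 (x + y) + e2 (x + z) + e2 (y + z))
        + (?k + ?k + ?k + ?k)"
      unfolding cube1[OF that] cube2[OF that] ..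
    also have "\<dots> = M (x + y) + M (x + z) + M (y + z) + M 0"
      unfolding M \<open>e1 0 = 0\<close> \<open>e2 0 = 0\<close> using that e1_A e2_A by (simp add: A.ac)
    finally show ?thesis .
  qed
  have M_0: "M x = 0" if "order3 (x + t)" "order3 (g + (x + t))" for x
  proof -
    have "conj_by (x + t + (x + t)) g = conj_by (x + \<tau> x) g''"
      unfolding g''_def g'_def \<tau>_def conj_by_def by (simp only: word_simps)
    then show ?thesis
      using order3_norm[OF that] unfolding M_def g'_def conj_by_add by simp
  qed
  \<comment> \<open>Each zero of \<open>M\<close> costs two order conditions, so 16 of them allow 8
    zeros.\<close>
  have pick: "\<exists>b\<in>H. \<forall>f\<in>set xs. M (f + b) = 0" if "set xs \<subseteq> H" "length xs \<le> 8" for xs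
  proof -
    have "\<exists>b\<in>H. \<forall>f\<in>set (xs @ map (\<lambda>f. g + f) xs). order3 (f + (b + t))"
      by (rule generic) (use that in auto)
    then obtain b where b: "b \<in> H" "\<forall>f\<in>set xs. order3 (f + (b + t)) \<and> order3 (g + f + (b + t))"
      by auto
    then have "\<forall>f\<in>set xs. M (f + b) = 0" by (auto intro!: M_0 simp: add.assoc)
    then show ?thesis using b(1) by blast
  qed
  \<comment> \<open>The cube grows by one edge at a time, each generic relative to the vertices
    already present, so that all vertices except 0 become zeros of \<open>M\<close>.\<close>
  obtain x where x: "x \<in> H" "M x = 0" using pick[of "[0]"] by auto
  obtain y where y: "y \<in> H" "M y = 0" "M (x + y) = 0" using pick[of "[0, x]"] x by auto
  obtain z where z: "z \<in> H" "M z = 0" "M (x + z) = 0" "M (y + z) = 0" "M (x + y + z) = 0"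
    using pick[of "[0, x, y, x + y]"] x y by auto
  have "M 0 = 0" using M_cube[of x y z] x y z by simp
  then have "g + conj_by t g + conj_by (t + t) g = 0"
    unfolding M_def \<tau>_def g''_def g'_def conj_by_add by simp
  then show ?thesis using order3_add_iff[OF order3_t] by simp
qed

end

section \<open>The symmetric group of a type\<close>

text \<open>This gives one type of class \<open>group_add\<close> holding both the translations of
  \<open>G\<close> and the automorphism, in place of a semidirect product.\<close>

typedef 'a bijection = "{f :: 'a \<Rightarrow> 'a. bij f}"
  morphisms apply_bijection Bijection
  by (rule exI[of _ id]) simp

lemma bij_apply_bijection: "bij (apply_bijection f)"
  using apply_bijection by auto

lemma apply_Bijection: "bij f \<Longrightarrow> apply_bijection (Bijection f) = f"
  by (simp add: Bijection_inverse)

instantiation bijection :: (type) group_add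
begin

definition "0 = Bijection id"
definition "f + g = Bijection (apply_bijection f \<circ> apply_bijection g)"
definition "- f = Bijection (inv_into UNIV (apply_bijection f))"
definition "f - g = f + - (g :: 'a bijection)"

instance
proof
  fix f g h :: "'a bijection"
  show "f + g + h = f + (g + h)" "0 + f = f" "f + 0 = f"
    unfolding plus_bijection_def zero_bijection_def
    by (simp_all add: apply_Bijection bij_apply_bijection bij_comp o_assoc apply_bijection_inverse)
  show "- f + f = 0"
    unfolding plus_bijection_def zero_bijection_def uminus_bijection_def
    using bij_apply_bijection[of f] by (simp add: apply_Bijection bij_imp_bij_inv bij_is_inj)
  show "f + - g = f - g" unfolding minus_bijection_def ..
qed

end

definition extend_bijection :: "'a set \<Rightarrow> ('a \<Rightarrow> 'a) \<Rightarrow> 'a bijection" where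
  "extend_bijection S \<beta> = Bijection (\<lambda>y. if y \<in> S then \<beta> y else y)"

lemma apply_extend_bijection:
  assumes "bij_betw \<beta> S S"
  shows "apply_bijection (extend_bijection S \<beta>) = (\<lambda>y. if y \<in> S then \<beta> y else y)"
proof -
  let ?f = "\<lambda>y. if y \<in> S then \<beta> y else y"
  have "bij_betw ?f S S" using assms by (simp cong: bij_betw_cong)
  moreover have "bij_betw ?f (- S) (- S)" by (auto simp: bij_betw_def inj_on_def)
  ultimately have "bij_betw ?f (S \<union> - S) (S \<union> - S)" by (rule bij_betw_combine) auto
  then show ?thesis unfolding extend_bijection_def by (simp add: apply_Bijection)
qed

lemma extend_bijection_add:
  assumes "bij_betw \<beta> S S" "bij_betw \<gamma> S S"
  shows "extend_bijection S \<beta> + extend_bijection S \<gamma> = extend_bijection S (\<beta> \<circ> \<gamma>)"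
  unfolding plus_bijection_def apply_extend_bijection[OF assms(1)] apply_extend_bijection[OF assms(2)]
  unfolding extend_bijection_def
  using bij_betwE[OF assms(2)] by (intro arg_cong[where f = Bijection]) auto

lemma extend_bijection_eq_iff:
  assumes "bij_betw \<beta> S S" "bij_betw \<gamma> S S"
  shows "extend_bijection S \<beta> = extend_bijection S \<gamma> \<longleftrightarrow> (\<forall>y\<in>S. \<beta> y = \<gamma> y)"
  unfolding apply_bijection_inject[symmetric] apply_extend_bijection[OF assms(1)]
    apply_extend_bijection[OF assms(2)]
  by (auto simp: fun_eq_iff)

lemma extend_bijection_id: "extend_bijection S id = 0"
  unfolding extend_bijection_def zero_bijection_def
  by (intro arg_cong[where f = Bijection]) auto

section \<open>Haar measure and the transfer to \<open>G\<close>\<close>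

text \<open>A union bound: the bad \<open>b\<close> for a given \<open>f\<close> form the complement
  of a left translate of \<open>X\<close>, of measure below 1/16, and at most 16 such sets cannot
  cover the group.\<close>

lemma translates_common_point:
  assumes "group G" and haar: "normalized_haar_measure G T m"
    and X: "X \<in> sets m" "measure m X > 15/16"
    and F: "finite F" "F \<subseteq> carrier G" "card F \<le> 16"
  shows "\<exists>b\<in>carrier G. \<forall>f\<in>F. f \<otimes>\<^bsub>G\<^esub> b \<in> X"
proof (rule ccontr)
  assume none: "\<not> ?thesis"
  interpret group G by fact
  have space: "emeasure m (space m) = 1" "space m = carrier G"
    using haar unfolding normalized_haar_measure_def by auto
  interpret finite_measure m by (rule finite_measureI, unfold space(1)) simp
  have m1: "measure m (space m) = 1" unfolding measure_def space(1) by simp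
  have XG: "X \<subseteq> carrier G" using sets.sets_into_space[OF X(1)] space by simp
  define B where "B f = space m - (inv\<^bsub>G\<^esub> f <#\<^bsub>G\<^esub> X)" for f
  have translate: "\<forall>A\<in>sets m. \<forall>g\<in>carrier G. g <#\<^bsub>G\<^esub> A \<in> sets m \<and> emeasure m (g <#\<^bsub>G\<^esub> A) = emeasure m A"
    using haar unfolding normalized_haar_measure_def by blast
  have B: "B f \<in> sets m" "measure m (B f) = 1 - measure m X" if "f \<in> F" for f
  proof -
    have "inv\<^bsub>G\<^esub> f <#\<^bsub>G\<^esub> X \<in> sets m" "emeasure m (inv\<^bsub>G\<^esub> f <#\<^bsub>G\<^esub> X) = emeasure m X"
      using translate X(1) F(2) that by blast+
    moreover from this(2) have "measure m (inv\<^bsub>G\<^esub> f <#\<^bsub>G\<^esub> X) = measure m X" unfolding measure_def by simp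
    ultimately show "B f \<in> sets m" "measure m (B f) = 1 - measure m X"
      unfolding B_def by (simp_all add: finite_measure_compl m1)
  qed
  have "space m \<subseteq> (\<Union>f\<in>F. B f)"
  proof
    fix b assume "b \<in> space m"
    then have b: "b \<in> carrier G" using space by simp
    then obtain f where f: "f \<in> F" "f \<otimes>\<^bsub>G\<^esub> b \<notin> X" using none by auto
    have "b \<notin> inv\<^bsub>G\<^esub> f <#\<^bsub>G\<^esub> X"
    proof
      assume "b \<in> inv\<^bsub>G\<^esub> f <#\<^bsub>G\<^esub> X"
      then obtain x where "x \<in> X" and b_eq: "b = inv\<^bsub>G\<^esub> f \<otimes>\<^bsub>G\<^esub> x" unfolding l_coset_def by auto
      moreover have "f \<in> carrier G" "x \<in> carrier G" using f F XG \<open>x \<in> X\<close> by auto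
      ultimately have "f \<otimes>\<^bsub>G\<^esub> b = x" unfolding b_eq by (simp add: m_assoc[symmetric])
      then show False using f \<open>x \<in> X\<close> by simp
    qed
    then show "b \<in> (\<Union>f\<in>F. B f)" using f b space unfolding B_def by auto
  qed
  then have "measure m (space m) \<le> measure m (\<Union>f\<in>F. B f)"
    using B F by (intro finite_measure_mono) auto
  also have "\<dots> \<le> (\<Sum>f\<in>F. measure m (B f))"
    using B F by (intro finite_measure_subadditive_finite) auto
  also have "\<dots> = real (card F) * (1 - measure m X)" using B by simp
  also have "\<dots> \<le> 16 * (1 - measure m X)"
    using F(3) bounded_measure[of X] m1 by (intro mult_right_mono) auto
  finally show False using X(2) m1 by simp
qed

theorem theorem3p1:
  fixes G :: "('a, 'b) monoid_scheme" and T :: "'a topology" and m :: "'a measure"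
    and \<alpha> :: "'a \<Rightarrow> 'a"
  assumes "compact_hausdorff_group G T"
    and "normalized_haar_measure G T m"
    and "\<alpha> \<in> iso G G"
    and "\<forall>x \<in> carrier G. \<alpha> (\<alpha> (\<alpha> x)) = x"
    and "{x \<in> carrier G. x \<otimes>\<^bsub>G\<^esub> \<alpha> x \<otimes>\<^bsub>G\<^esub> \<alpha> (\<alpha> x) = \<one>\<^bsub>G\<^esub>} \<in> sets m"
    and "measure m {x \<in> carrier G. x \<otimes>\<^bsub>G\<^esub> \<alpha> x \<otimes>\<^bsub>G\<^esub> \<alpha> (\<alpha> x) = \<one>\<^bsub>G\<^esub>} > 15/16"
  shows "{x \<in> carrier G. x \<otimes>\<^bsub>G\<^esub> \<alpha> x \<otimes>\<^bsub>G\<^esub> \<alpha> (\<alpha> x) = \<one>\<^bsub>G\<^esub>} = carrier G"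
proof -
  interpret group G using assms(1) unfolding compact_hausdorff_group_def by simp
  define X where "X = {x \<in> carrier G. x \<otimes>\<^bsub>G\<^esub> \<alpha> x \<otimes>\<^bsub>G\<^esub> \<alpha> (\<alpha> x) = \<one>\<^bsub>G\<^esub>}"
  have \<alpha>: "bij_betw \<alpha> (carrier G) (carrier G)" and \<alpha>_hom: "\<alpha> \<in> hom G G"
    using assms(3) by (auto simp: iso_def)
  have \<alpha>_mem [simp]: "\<alpha> x \<in> carrier G" if "x \<in> carrier G" for x
    using bij_betwE[OF \<alpha>] that by auto
  have \<alpha>_mult: "\<alpha> (x \<otimes>\<^bsub>G\<^esub> y) = \<alpha> x \<otimes>\<^bsub>G\<^esub> \<alpha> y" if "x \<in> carrier G" "y \<in> carrier G" for x y
    using hom_mult[OF \<alpha>_hom that] .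
  \<comment> \<open>The left regular representation of \<open>G\<close>; together with
    \<open>t\<close> it realizes the coset on which the algebra works.\<close>
  define L where "L x = extend_bijection (carrier G) (\<lambda>y. x \<otimes>\<^bsub>G\<^esub> y)" for x
  define t where "t = extend_bijection (carrier G) \<alpha>"
  have mult_bij: "bij_betw (\<lambda>y. x \<otimes>\<^bsub>G\<^esub> y) (carrier G) (carrier G)" if "x \<in> carrier G" for x
    by (rule bij_betwI[where g = "\<lambda>y. inv\<^bsub>G\<^esub> x \<otimes>\<^bsub>G\<^esub> y"]) (use that in \<open>auto simp: m_assoc[symmetric]\<close>)
  have comp_bij: "bij_betw (\<beta> \<circ> \<gamma>) (carrier G) (carrier G)"
    if "bij_betw \<beta> (carrier G) (carrier G)" "bij_betw \<gamma> (carrier G) (carrier G)" for \<beta> \<gamma>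
    using bij_betw_trans[OF that(2,1)] .
  note eq_iff = extend_bijection_eq_iff extend_bijection_add comp_bij mult_bij \<alpha>
  have L_add: "L x + L y = L (x \<otimes>\<^bsub>G\<^esub> y)" if "x \<in> carrier G" "y \<in> carrier G" for x y
    unfolding L_def using that by (simp add: eq_iff m_assoc)
  have L_0: "L x = 0 \<longleftrightarrow> x = \<one>\<^bsub>G\<^esub>" if "x \<in> carrier G" for x
  proof -
    have "L x = 0 \<longleftrightarrow> (\<forall>y\<in>carrier G. x \<otimes>\<^bsub>G\<^esub> y = id y)"
      unfolding L_def extend_bijection_id[of "carrier G", symmetric]
      by (rule extend_bijection_eq_iff) (use mult_bij that in auto)
    also have "\<dots> \<longleftrightarrow> x = \<one>\<^bsub>G\<^esub>" using that by (auto dest: bspec[of _ _ "\<one>\<^bsub>G\<^esub>"])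
    finally show ?thesis .
  qed
  have L_minus: "- L x = L (inv\<^bsub>G\<^esub> x)" if "x \<in> carrier G" for x
    using L_add[of x "inv\<^bsub>G\<^esub> x"] L_0[of "\<one>\<^bsub>G\<^esub>"] that by (intro minus_unique) simp
  \<comment> \<open>Hence conjugation by \<open>t\<close> acts on the translations as
    \<open>\<alpha>\<close>.\<close>
  have t_L: "t + L x = L (\<alpha> x) + t" if "x \<in> carrier G" for x
    unfolding L_def t_def using that by (simp add: eq_iff \<alpha>_mult)
  have t3: "t + t + t = 0"
  proof -
    have "t + t + t = extend_bijection (carrier G) (\<alpha> \<circ> \<alpha> \<circ> \<alpha>)"
      unfolding t_def by (simp add: extend_bijection_add comp_bij \<alpha>)
    also have "\<dots> = extend_bijection (carrier G) id"
      using assms(4) by (subst extend_bijection_eq_iff) (auto intro!: comp_bij \<alpha>)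
    finally show ?thesis unfolding extend_bijection_id .
  qed
  have order3_iff: "order3 (L h + t) \<longleftrightarrow> h \<in> X" if h: "h \<in> carrier G" for h
  proof -
    have "conj_by t (L x) = L (\<alpha> x)" if "x \<in> carrier G" for x
      unfolding conj_by_def t_L[OF that] by simp
    then have "L h + conj_by t (L h) + conj_by (t + t) (L h) = L (h \<otimes>\<^bsub>G\<^esub> \<alpha> h \<otimes>\<^bsub>G\<^esub> \<alpha> (\<alpha> h))"
      using h by (simp add: conj_by_add L_add)
    then show ?thesis
      using order3_add_iff[of t "L h"] t3 L_0 h unfolding order3_def X_def by simp
  qed
  interpret C: generic_order3_coset "L ` carrier G" t
  proof
    show "0 \<in> L ` carrier G" using L_0[of "\<one>\<^bsub>G\<^esub>"] by (metis one_closed image_eqI)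
    show "x + y \<in> L ` carrier G" if "x \<in> L ` carrier G" "y \<in> L ` carrier G" for x y
      using that by (auto simp: L_add)
    show "- x \<in> L ` carrier G" if "x \<in> L ` carrier G" for x
      using that by (auto simp: L_minus)
    show "order3 t" unfolding order3_def by (rule t3)
    show "conj_by t x \<in> L ` carrier G" if "x \<in> L ` carrier G" for x
      using that unfolding conj_by_def by (auto simp: t_L)
    fix xs assume xs: "set xs \<subseteq> L ` carrier G" "length xs \<le> 16"
    \<comment> \<open>The conditions are pulled back along \<open>L\<close> by choosing preimages,
      at most as many as the list has entries.\<close>
    let ?F = "inv_into (carrier G) L ` set xs"
    have "card ?F \<le> 16"
      using card_image_le[of "set xs" "inv_into (carrier G) L"] card_length[of xs] xs(2) by simp
    moreover have F: "?F \<subseteq> carrier G" by (intro image_subsetI inv_into_into subsetD[OF xs(1)])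
    ultimately have "\<exists>b\<in>carrier G. \<forall>f\<in>?F. f \<otimes>\<^bsub>G\<^esub> b \<in> X"
      by (intro translates_common_point[OF is_group assms(2) assms(5,6), folded X_def]) simp_all
    then obtain b where b: "b \<in> carrier G" "\<forall>f\<in>?F. f \<otimes>\<^bsub>G\<^esub> b \<in> X" by blast
    have "order3 (f + (L b + t))" if "f \<in> set xs" for f
    proof -
      let ?f = "inv_into (carrier G) L f"
      have f: "?f \<in> carrier G" "L ?f = f"
        using F that f_inv_into_f[OF subsetD[OF xs(1) that]] by auto
      then have "order3 (L (?f \<otimes>\<^bsub>G\<^esub> b) + t)" using b that order3_iff by auto
      then show ?thesis using f b(1) L_add[of ?f b] by (simp add: add.assoc[symmetric])
    qed
    then show "\<exists>b\<in>L ` carrier G. \<forall>f\<in>set xs. order3 (f + (b + t))" using b(1) by blast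
  qed
  have "h \<in> X" if "h \<in> carrier G" for h
    using C.order3_coset[of "L h"] order3_iff that by blast
  then show ?thesis unfolding X_def by blast
qed

end
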